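(* Let $0<\theta\le1$, $0\le\mu\le1$, let $(\tau_n)_{n\ge1}$ be positive step sizes, and let $(u^n)_{n\ge0}$ be generated by the variable-step $(\theta,\mu)$-method, with $u^1$ computed by the linearly implicit Euler method (both described in the context). Then for all $m\ge2$ $$\frac12\|\nabla u^m\|^2+\sum_{n=1}^m\tau_n\|d_tu^n\|_\star^2+\frac{\tau_1^2}{2}\|\nabla d_tu^1\|^2+\Big(\theta-\frac12\Big)\sum_{n=2}^m\tau_n^2\|\nabla d_tu^n\|^2=\frac12\|\nabla u^0\|^2 .$$
   Context: Setting. $\Omega\subset\mathbb{R}^d$ is a bounded domain with Lipschitz boundary, $\Gamma_D\subset\partial\Omega$ has positive surface measure, and $u_D:\Gamma_D\to\mathbb{R}^\ell$ is the trace of some $\tilde u_D\in H^1(\Omega;\mathbb{R}^\ell)$ with $|\tilde u_D|=1$ a.e. in $\Omega$. $H^1_D(\Omega;\mathbb{R}^\ell)$ is the subspace of $H^1(\Omega;\mathbb{R}^\ell)$ of functions with vanishing trace on $\Gamma_D$. $(\cdot,\cdot)$ and $\|\cdot\|$ are the $L^2(\Omega)$ inner product and norm; $|\cdot|$ is the Euclidean length and $\cdot$ between vectors the Euclidean inner product in $\mathbb{R}^\ell$ (applied pointwise to vector fields). $(\cdot,\cdot)_\star$ is either the $L^2$-inner product $(\cdot,\cdot)$ or the $H^1$-inner product $(\nabla\cdot,\nabla\cdot)$ on $H^1_D(\Omega;\mathbb{R}^\ell)$, with induced norm $\|\cdot\|_\star$. There is a constant $c_\star>0$ with $\|v\|\le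 c_\star^{1/2}\|v\|_\star$ for all $v\in H^1_D(\Omega;\mathbb{R}^\ell)$. The variable-step $(\theta,\mu)$-method. Given step sizes $\tau_n>0$, $n\ge1$, write $d_tu^n:=(u^n-u^{n-1})/\tau_n$. The starting value is $u^0\in H^1(\Omega;\mathbb{R}^\ell)$ with $u^0|_{\Gamma_D}=u_D$ and $|u^0|=1$ a.e. in $\Omega$. Step 1 (linearly implicit Euler): $d_tu^1\in H^1_D(\Omega;\mathbb{R}^\ell)$ satisfies $d_tu^1\cdot u^0=0$ a.e. and $(d_tu^1,v)_\star+(\nabla u^0+\tau_1\nabla d_tu^1,\nabla v)=0$ for all $v\in H^1_D(\Omega;\mathbb{R}^\ell)$ with $v\cdot u^0=0$ a.e.; set $u^1:=u^0+\tau_1d_tu^1$. Step $n\ge2$: set $\widehat u^{\,n-1+\mu}:=u^{n-1}+\mu\tau_nd_tu^{n-1}$; $d_tu^n\in H^1_D(\Omega;\mathbb{R}^\ell)$ satisfies $d_tu^n\cdot\widehat u^{\,n-1+\mu}=0$ a.e. and $(d_tu^n,v)_\star+(\nabla[u^{n-1}+\theta\tau_nd_tu^n],\nabla v)=0$ for all $v\in H^1_D(\Omega;\mathbb{R}^\ell)$ with $v\cdot\widehat u^{\,n-1+\mu}=0$ a.e.; set $u^n:=u^{n-1}+\tau_nd_tu^n$. *)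

theory Defs
  imports "HOL-Analysis.Analysis"
begin

section \<open>Lipschitz domains and surface measure\<close>

text \<open>
  Near each boundary point, the domain is the strict epigraph of a Lipschitz function in the
  direction of some unit vector \<open>e\<close>.  The hyperplane orthogonal to \<open>e\<close> plays the role of
  the space of the remaining \<open>d - 1\<close> coordinates.
\<close>

definition lipschitz_boundary :: "'a::euclidean_space set \<Rightarrow> bool" where
  "lipschitz_boundary \<Omega> \<longleftrightarrow>
     (\<forall>x0\<in>frontier \<Omega>. \<exists>r>0. \<exists>e L. \<exists>\<gamma> :: 'a \<Rightarrow> real. norm e = 1 \<and>
        L-lipschitz_on {y. y \<bullet> e = 0} \<gamma> \<and>
        \<Omega> \<inter> ball x0 r = {x \<in> ball x0 r. \<gamma> (x - (x \<bullet> e) *\<^sub>R e) < x \<bullet> e})"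

definition bounded_lipschitz_domain :: "'a::euclidean_space set \<Rightarrow> bool" where
  "bounded_lipschitz_domain \<Omega> \<longleftrightarrow>
     open \<Omega> \<and> connected \<Omega> \<and> \<Omega> \<noteq> {} \<and> bounded \<Omega> \<and> lipschitz_boundary \<Omega>"

text \<open>
  The \<open>k\<close>-dimensional Hausdorff outer measure, normalised by the volume of the
  \<open>k\<close>-dimensional unit ball.  The case distinction gives the empty set weight \<open>0\<close> also for
  \<open>k = 0\<close>; covering sets have to be bounded because the library's \<open>diameter\<close> is unspecified
  for unbounded sets.
\<close>

definition hausdorff_gauge :: "nat \<Rightarrow> 'a::metric_space set \<Rightarrow> ennreal" where
  "hausdorff_gauge k C =
     (if C = {} then 0 else ennreal (unit_ball_vol (real k) * (diameter C / 2) ^ k))"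

definition hausdorff_covers :: "real \<Rightarrow> 'a::metric_space set \<Rightarrow> (nat \<Rightarrow> 'a set) set" where
  "hausdorff_covers \<delta> A =
     {C. A \<subseteq> (\<Union>i. C i) \<and> (\<forall>i. bounded (C i) \<and> diameter (C i) \<le> \<delta>)}"

definition hausdorff_outer :: "nat \<Rightarrow> 'a::metric_space set \<Rightarrow> ennreal" where
  "hausdorff_outer k A =
     (SUP \<delta>\<in>{0<..}. INF C\<in>hausdorff_covers \<delta> A. (\<Sum>i. hausdorff_gauge k (C i)))"

text \<open>The measure on the boundary, defined on all Caratheodory-measurable subsets.\<close>

definition surface_measure :: "'a::euclidean_space set \<Rightarrow> 'a measure" where
  "surface_measure \<Omega> =
     measure_of (frontier \<Omega>)
       (lambda_system (frontier \<Omega>) (Pow (frontier \<Omega>)) (hausdorff_outer (DIM('a) - 1)))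
       (hausdorff_outer (DIM('a) - 1))"

lemma hausdorff_outer_mono: "A \<subseteq> B \<Longrightarrow> hausdorff_outer k A \<le> hausdorff_outer k B"
  unfolding hausdorff_outer_def
  by (intro SUP_mono' INF_superset_mono) (auto simp: hausdorff_covers_def)

lemma hausdorff_outer_empty: "hausdorff_outer k {} = 0"
proof -
  have "(INF C\<in>hausdorff_covers \<delta> {}. (\<Sum>i. hausdorff_gauge k (C i))) \<le> 0" if "\<delta> > 0" for \<delta>
    by (rule INF_lower2[of "\<lambda>_. {}"]) (use that in \<open>auto simp: hausdorff_covers_def hausdorff_gauge_def\<close>)
  then have "hausdorff_outer k {} \<le> 0"
    unfolding hausdorff_outer_def by (intro SUP_least) auto
  then show ?thesis by simp
qed

lemma hausdorff_outer_UN: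
  fixes A :: "nat \<Rightarrow> 'a::metric_space set"
  shows "hausdorff_outer k (\<Union>i. A i) \<le> (\<Sum>i. hausdorff_outer k (A i))"
proof -
  define h where "h \<delta> A = (INF C\<in>hausdorff_covers \<delta> A. (\<Sum>i. hausdorff_gauge k (C i)))"
    for \<delta> and A :: "'a set"
  have h_le: "h \<delta> B \<le> hausdorff_outer k B" if "\<delta> > 0" for \<delta> B
    unfolding hausdorff_outer_def h_def by (rule SUP_upper) (use that in simp)
  have "h \<delta> (\<Union>i. A i) \<le> (\<Sum>i. h \<delta> (A i))" for \<delta>
  proof (rule ennreal_le_epsilon)
    fix e :: real assume fin: "(\<Sum>i. h \<delta> (A i)) < top" and e: "0 < e"
    have "\<exists>C\<in>hausdorff_covers \<delta> (A n).
        (\<Sum>i. hausdorff_gauge k (C i)) \<le> h \<delta> (A n) + ennreal (e * (1/2) ^ Suc n)" for n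
    proof -
      have "h \<delta> (A n) < top"
        using fin by (rule ennreal_suminf_lessD)
      then have "h \<delta> (A n) < h \<delta> (A n) + ennreal (e * (1/2) ^ Suc n)"
        using e by (cases "h \<delta> (A n)") (auto simp: ennreal_less_iff simp flip: ennreal_plus)
      then show ?thesis
        unfolding h_def by (subst (asm) INF_less_iff) (auto intro: less_imp_le)
    qed
    then obtain C where C: "\<And>n. C n \<in> hausdorff_covers \<delta> (A n)"
      and le: "\<And>n. (\<Sum>i. hausdorff_gauge k (C n i)) \<le> h \<delta> (A n) + ennreal (e * (1/2) ^ Suc n)"
      by metis
    let ?D = "case_prod C \<circ> prod_decode"
    have "A n \<subseteq> (\<Union>i. ?D i)" for n
    proof
      fix x assume "x \<in> A n"
      then obtain i where "x \<in> C n i" using C[of n] by (auto simp: hausdorff_covers_def)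
      then have "x \<in> ?D (prod_encode (n, i))" by simp
      then show "x \<in> (\<Union>i. ?D i)" by blast
    qed
    then have "?D \<in> hausdorff_covers \<delta> (\<Union>i. A i)"
      using C by (auto simp: hausdorff_covers_def split: prod.split)
    then have "h \<delta> (\<Union>i. A i) \<le> (\<Sum>i. hausdorff_gauge k (?D i))"
      unfolding h_def by (rule INF_lower)
    also have "\<dots> = (\<Sum>n. \<Sum>i. hausdorff_gauge k (C n i))"
      using suminf_ennreal_2dimen[of "\<lambda>n. \<Sum>i. hausdorff_gauge k (C n i)"
          "\<lambda>(n, i). hausdorff_gauge k (C n i)"]
      by (simp add: o_def case_prod_beta)
    also have "\<dots> \<le> (\<Sum>n. h \<delta> (A n) + ennreal (e * (1/2) ^ Suc n))"
      by (intro suminf_le le) auto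
    also have "\<dots> = (\<Sum>n. h \<delta> (A n)) + (\<Sum>n. ennreal (e * (1/2) ^ Suc n))"
      by (intro suminf_add[symmetric]) auto
    also have "(\<Sum>n. ennreal (e * (1/2) ^ Suc n)) = ennreal e"
      using power_half_series sums_mult[of "\<lambda>n. (1/2::real) ^ Suc n" 1 e] e
      by (intro suminf_ennreal_eq) auto
    finally show "h \<delta> (\<Union>i. A i) \<le> (\<Sum>i. h \<delta> (A i)) + ennreal e" .
  qed
  then have "h \<delta> (\<Union>i. A i) \<le> (\<Sum>i. hausdorff_outer k (A i))" if "\<delta> > 0" for \<delta>
    by (rule order_trans) (use that in \<open>intro suminf_le h_le; auto\<close>)
  then show ?thesis
    unfolding hausdorff_outer_def[of k "\<Union>i. A i"] h_def by (intro SUP_least) auto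
qed

lemma emeasure_surface_measure:
  fixes \<Omega> :: "'a::euclidean_space set"
  assumes "A \<in> sets (surface_measure \<Omega>)"
  shows "emeasure (surface_measure \<Omega>) A = hausdorff_outer (DIM('a) - 1) A"
proof -
  let ?H = "hausdorff_outer (DIM('a) - 1) :: 'a set \<Rightarrow> ennreal"
  let ?F = "frontier \<Omega>"
  have "outer_measure_space (Pow ?F) ?H"
    unfolding outer_measure_space_def positive_def increasing_def countably_subadditive_def
    by (auto simp: hausdorff_outer_empty hausdorff_outer_mono hausdorff_outer_UN)
  then have ms: "measure_space ?F (lambda_system ?F (Pow ?F) ?H) ?H"
    using sigma_algebra.caratheodory_lemma[OF sigma_algebra_Pow] by blast
  then interpret sigma_algebra ?F "lambda_system ?F (Pow ?F) ?H"
    by (simp add: measure_space_def)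
  have "A \<in> lambda_system ?F (Pow ?F) ?H"
    using assms unfolding surface_measure_def by (subst (asm) sets_measure_of_eq)
  with ms show ?thesis
    unfolding surface_measure_def measure_space_def
    by (subst emeasure_measure_of_sigma) auto
qed


section \<open>Square integrable functions\<close>

text \<open>
  Elements of function spaces are represented by functions, not by equivalence classes;
  their values outside the space of the measure are irrelevant.
\<close>

definition L2 :: "'a measure \<Rightarrow> ('a \<Rightarrow> 'b::euclidean_space) set" where
  "L2 M = {f \<in> borel_measurable M. integrable M (\<lambda>x. (norm (f x))\<^sup>2)}"

definition l2_inner :: "'a measure \<Rightarrow> ('a \<Rightarrow> 'b::euclidean_space) \<Rightarrow> ('a \<Rightarrow> 'b) \<Rightarrow> real" where
  "l2_inner M f g = (\<integral>x. f x \<bullet> g x \<partial>M)"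

definition induced_norm :: "('f \<Rightarrow> 'f \<Rightarrow> real) \<Rightarrow> 'f \<Rightarrow> real" where
  "induced_norm ip f = sqrt (ip f f)"

abbreviation l2_norm :: "'a measure \<Rightarrow> ('a \<Rightarrow> 'b::euclidean_space) \<Rightarrow> real" where
  "l2_norm M \<equiv> induced_norm (l2_inner M)"


section \<open>Smooth functions and test functions\<close>

primrec Ck :: "nat \<Rightarrow> ('a::euclidean_space \<Rightarrow> 'b::real_normed_vector) \<Rightarrow> bool" where
  "Ck 0 f \<longleftrightarrow> continuous_on UNIV f"
| "Ck (Suc k) f \<longleftrightarrow> (\<forall>x. f differentiable (at x)) \<and>
     (\<forall>b\<in>Basis. Ck k (\<lambda>x. frechet_derivative f (at x) b))"

definition smooth :: "('a::euclidean_space \<Rightarrow> 'b::real_normed_vector) \<Rightarrow> bool" where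
  "smooth f \<longleftrightarrow> (\<forall>k. Ck k f)"

definition test_function :: "'a::euclidean_space set \<Rightarrow> ('a \<Rightarrow> real) \<Rightarrow> bool" where
  "test_function \<Omega> \<phi> \<longleftrightarrow> smooth \<phi> \<and>
     compact (closure {x. \<phi> x \<noteq> 0}) \<and> closure {x. \<phi> x \<noteq> 0} \<subseteq> \<Omega>"


section \<open>The Sobolev space \<open>H\<^sup>1\<close> of vector fields\<close>

text \<open>
  The gradient of a vector field is its Jacobian matrix: \<open>G x $ i $ j\<close> is the partial derivative
  in direction \<open>j\<close> of the component \<open>i\<close>.  The inner product of matrices
  of type \<open>real^'d^'l\<close> is the Frobenius inner product.
\<close>

definition weak_gradient ::
  "(real^'d) set \<Rightarrow> (real^'d \<Rightarrow> real^'l) \<Rightarrow> (real^'d \<Rightarrow> real^'d^'l) \<Rightarrow> bool" where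
  "weak_gradient \<Omega> u G \<longleftrightarrow>
     (\<forall>\<phi> i j. test_function \<Omega> \<phi> \<longrightarrow>
        (\<integral>x. u x $ i * frechet_derivative \<phi> (at x) (axis j 1) \<partial>lebesgue_on \<Omega>) =
        - (\<integral>x. G x $ i $ j * \<phi> x \<partial>lebesgue_on \<Omega>))"

definition H1 :: "(real^'d) set \<Rightarrow> (real^'d \<Rightarrow> real^'l) set" where
  "H1 \<Omega> = {u \<in> L2 (lebesgue_on \<Omega>). \<exists>G\<in>L2 (lebesgue_on \<Omega>). weak_gradient \<Omega> u G}"

text \<open>A representative of the weak gradient, which is unique up to null sets.\<close>

definition wgrad :: "(real^'d) set \<Rightarrow> (real^'d \<Rightarrow> real^'l) \<Rightarrow> real^'d \<Rightarrow> real^'d^'l" where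
  "wgrad \<Omega> u = (SOME G. G \<in> L2 (lebesgue_on \<Omega>) \<and> weak_gradient \<Omega> u G)"

definition grad_inner ::
  "(real^'d) set \<Rightarrow> (real^'d \<Rightarrow> real^'l) \<Rightarrow> (real^'d \<Rightarrow> real^'l) \<Rightarrow> real" where
  "grad_inner \<Omega> u v = l2_inner (lebesgue_on \<Omega>) (wgrad \<Omega> u) (wgrad \<Omega> v)"

text \<open>
  The graph of the trace operator: the closure in \<open>H\<^sup>1(\<Omega>) \<times> L\<^sup>2(\<partial>\<Omega>)\<close> of the restrictions
  \<open>(\<phi>|\<Omega>, \<phi>|\<partial>\<Omega>)\<close> of smooth functions \<open>\<phi>\<close> on the whole space, which are dense in
  \<open>H\<^sup>1(\<Omega>)\<close> for bounded Lipschitz domains.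
\<close>

definition has_trace ::
  "(real^'d) set \<Rightarrow> (real^'d \<Rightarrow> real^'l) \<Rightarrow> (real^'d \<Rightarrow> real^'l) \<Rightarrow> bool" where
  "has_trace \<Omega> u g \<longleftrightarrow> u \<in> H1 \<Omega> \<and> g \<in> L2 (surface_measure \<Omega>) \<and>
     (\<exists>\<phi> :: nat \<Rightarrow> real^'d \<Rightarrow> real^'l. (\<forall>k. smooth (\<phi> k)) \<and>
        (\<lambda>k. l2_norm (lebesgue_on \<Omega>) (\<lambda>x. \<phi> k x - u x)) \<longlonglongrightarrow> 0 \<and>
        (\<lambda>k. l2_norm (lebesgue_on \<Omega>) (wgrad \<Omega> (\<lambda>x. \<phi> k x - u x))) \<longlonglongrightarrow> 0 \<and>
        (\<lambda>k. l2_norm (surface_measure \<Omega>) (\<lambda>x. \<phi> k x - g x)) \<longlonglongrightarrow> 0)"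

definition has_trace_on ::
  "(real^'d) set \<Rightarrow> (real^'d) set \<Rightarrow> (real^'d \<Rightarrow> real^'l) \<Rightarrow> (real^'d \<Rightarrow> real^'l) \<Rightarrow> bool" where
  "has_trace_on \<Omega> \<Gamma> u g \<longleftrightarrow>
     (\<exists>h. has_trace \<Omega> u h \<and> (AE x in surface_measure \<Omega>. x \<in> \<Gamma> \<longrightarrow> h x = g x))"

definition H1D :: "(real^'d) set \<Rightarrow> (real^'d) set \<Rightarrow> (real^'d \<Rightarrow> real^'l) set" where
  "H1D \<Omega> \<Gamma> = {v \<in> H1 \<Omega>. has_trace_on \<Omega> \<Gamma> v (\<lambda>_. 0)}"


section \<open>The variable-step \<open>(\<theta>,\<mu>)\<close>-method\<close>

definition unit_length :: "(real^'d) set \<Rightarrow> (real^'d \<Rightarrow> real^'l) \<Rightarrow> bool" where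
  "unit_length \<Omega> u \<longleftrightarrow> (AE x in lebesgue_on \<Omega>. norm (u x) = 1)"

definition tangential :: "(real^'d) set \<Rightarrow> (real^'d \<Rightarrow> real^'l) \<Rightarrow> (real^'d \<Rightarrow> real^'l) \<Rightarrow> bool" where
  "tangential \<Omega> w v \<longleftrightarrow> (AE x in lebesgue_on \<Omega>. v x \<bullet> w x = 0)"

definition dt :: "(nat \<Rightarrow> real) \<Rightarrow> (nat \<Rightarrow> 'a \<Rightarrow> 'b::real_vector) \<Rightarrow> nat \<Rightarrow> 'a \<Rightarrow> 'b" where
  "dt \<tau> u n = (\<lambda>x. (u n x - u (n - 1) x) /\<^sub>R \<tau> n)"

definition extrapolation ::
  "real \<Rightarrow> (nat \<Rightarrow> real) \<Rightarrow> (nat \<Rightarrow> 'a \<Rightarrow> 'b::real_vector) \<Rightarrow> nat \<Rightarrow> 'a \<Rightarrow> 'b" where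
  "extrapolation \<mu> \<tau> u n = (\<lambda>x. u (n - 1) x + (\<mu> * \<tau> n) *\<^sub>R dt \<tau> u (n - 1) x)"

text \<open>
  The update \<open>u n = u (n - 1) + \<tau> n * dt \<tau> u n\<close> holds by definition of \<open>dt\<close>, as \<open>\<tau> n > 0\<close>.
\<close>

definition euler_start ::
  "(real^'d) set \<Rightarrow> (real^'d) set \<Rightarrow>
   ((real^'d \<Rightarrow> real^'l) \<Rightarrow> (real^'d \<Rightarrow> real^'l) \<Rightarrow> real) \<Rightarrow>
   (nat \<Rightarrow> real) \<Rightarrow> (nat \<Rightarrow> real^'d \<Rightarrow> real^'l) \<Rightarrow> bool" where
  "euler_start \<Omega> \<Gamma> ip \<tau> u \<longleftrightarrow>
     dt \<tau> u 1 \<in> H1D \<Omega> \<Gamma> \<and> tangential \<Omega> (u 0) (dt \<tau> u 1) \<and>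
     (\<forall>v\<in>H1D \<Omega> \<Gamma>. tangential \<Omega> (u 0) v \<longrightarrow>
        ip (dt \<tau> u 1) v +
        l2_inner (lebesgue_on \<Omega>)
          (\<lambda>x. wgrad \<Omega> (u 0) x + \<tau> 1 *\<^sub>R wgrad \<Omega> (dt \<tau> u 1) x) (wgrad \<Omega> v) = 0)"

definition theta_mu_step ::
  "(real^'d) set \<Rightarrow> (real^'d) set \<Rightarrow>
   ((real^'d \<Rightarrow> real^'l) \<Rightarrow> (real^'d \<Rightarrow> real^'l) \<Rightarrow> real) \<Rightarrow> real \<Rightarrow> real \<Rightarrow>
   (nat \<Rightarrow> real) \<Rightarrow> (nat \<Rightarrow> real^'d \<Rightarrow> real^'l) \<Rightarrow> nat \<Rightarrow> bool" where
  "theta_mu_step \<Omega> \<Gamma> ip \<theta> \<mu> \<tau> u n \<longleftrightarrow>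
     dt \<tau> u n \<in> H1D \<Omega> \<Gamma> \<and> tangential \<Omega> (extrapolation \<mu> \<tau> u n) (dt \<tau> u n) \<and>
     (\<forall>v\<in>H1D \<Omega> \<Gamma>. tangential \<Omega> (extrapolation \<mu> \<tau> u n) v \<longrightarrow>
        ip (dt \<tau> u n) v +
        grad_inner \<Omega> (\<lambda>x. u (n - 1) x + (\<theta> * \<tau> n) *\<^sub>R dt \<tau> u n x) v = 0)"

definition theta_mu_method ::
  "(real^'d) set \<Rightarrow> (real^'d) set \<Rightarrow> (real^'d \<Rightarrow> real^'l) \<Rightarrow>
   ((real^'d \<Rightarrow> real^'l) \<Rightarrow> (real^'d \<Rightarrow> real^'l) \<Rightarrow> real) \<Rightarrow> real \<Rightarrow> real \<Rightarrow>
   (nat \<Rightarrow> real) \<Rightarrow> (nat \<Rightarrow> real^'d \<Rightarrow> real^'l) \<Rightarrow> bool" where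
  "theta_mu_method \<Omega> \<Gamma> uD ip \<theta> \<mu> \<tau> u \<longleftrightarrow>
     u 0 \<in> H1 \<Omega> \<and> has_trace_on \<Omega> \<Gamma> (u 0) uD \<and> unit_length \<Omega> (u 0) \<and>
     euler_start \<Omega> \<Gamma> ip \<tau> u \<and>
     (\<forall>n\<ge>2. theta_mu_step \<Omega> \<Gamma> ip \<theta> \<mu> \<tau> u n)"

end

theory Submission
  imports Defs
begin

text \<open>
  Each step of the scheme is tested with \<open>v = d\<^sub>tu\<^sup>n\<close>, which is itself admissible.  Expanding
  \<open>\<parallel>\<nabla>u\<^sup>n\<parallel>\<^sup>2\<close> with \<open>u\<^sup>n = u\<^sup>n\<^sup>-\<^sup>1 + \<tau>\<^sub>n d\<^sub>tu\<^sup>n\<close> turns the tested equations into exact energy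
  increments, and these telescope.  The expansion needs the chosen representatives of the weak
  gradient to be linear almost everywhere, that is, uniqueness of weak gradients.  For this,
  indicators of boxes are obtained as pointwise limits of test functions, namely products of
  rescaled copies of \<open>exp (- 1 / t)\<close>, so that a function orthogonal to all test functions has zero
  integral over all boxes.
\<close>

section \<open>Smooth approximation of box indicators\<close>

lemma Ck_const: "Ck k (\<lambda>_. c)"
  by (induction k arbitrary: c) (auto simp: frechet_derivative_const)

lemma Ck_imp_continuous: "Ck k f \<Longrightarrow> continuous_on UNIV f"
  by (cases k) (auto intro!: differentiable_imp_continuous_on simp: differentiable_on_def)

lemma Ck_Suc_imp: "Ck (Suc k) f \<Longrightarrow> Ck k f"
  by (induction k arbitrary: f) (use Ck_imp_continuous[of "Suc 0"] in auto)

lemma Ck_add: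
  assumes "Ck k f" "Ck k g"
  shows "Ck k (\<lambda>x. f x + g x)"
  using assms
proof (induction k arbitrary: f g)
  case 0
  then show ?case by (auto intro: continuous_intros)
next
  case (Suc k)
  then have "frechet_derivative (\<lambda>x. f x + g x) (at x)
      = (\<lambda>b. frechet_derivative f (at x) b + frechet_derivative g (at x) b)" for x
    by (intro frechet_derivative_at[symmetric] has_derivative_add)
       (auto simp: frechet_derivative_works)
  with Suc show ?case by auto
qed

text \<open>The product rule leaves one factor undifferentiated; \<open>Ck_Suc_imp\<close> lowers
  its order so that the induction hypothesis applies to both summands.\<close>

lemma Ck_mult:
  fixes f g :: "'a::euclidean_space \<Rightarrow> real"
  assumes "Ck k f" "Ck k g"
  shows "Ck k (\<lambda>x. f x * g x)"
  using assms
proof (induction k arbitrary: f g)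
  case 0
  then show ?case by (auto intro: continuous_intros)
next
  case (Suc k)
  have eq: "frechet_derivative (\<lambda>x. f x * g x) (at x)
      = (\<lambda>b. f x * frechet_derivative g (at x) b + frechet_derivative f (at x) b * g x)" for x
    using Suc.prems
    by (intro frechet_derivative_at[symmetric] has_derivative_mult)
       (auto simp: frechet_derivative_works)
  show ?case
    using Suc.prems Suc.IH Ck_Suc_imp[OF Suc.prems(1)] Ck_Suc_imp[OF Suc.prems(2)]
    by (auto simp: eq intro!: Ck_add)
qed

lemma Ck_prod:
  fixes f :: "'i \<Rightarrow> 'a::euclidean_space \<Rightarrow> real"
  assumes "\<And>i. i \<in> I \<Longrightarrow> Ck k (f i)"
  shows "Ck k (\<lambda>x. \<Prod>i\<in>I. f i x)"
  using assms by (induction I rule: infinite_finite_induct) (auto intro: Ck_const Ck_mult)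

text \<open>The polynomial factors in \<open>1 / t\<close> make this family closed under differentiation.\<close>

definition flat_exp :: "real poly \<Rightarrow> real \<Rightarrow> real" where
  "flat_exp p t = (if t > 0 then poly p (1 / t) * exp (- 1 / t) else 0)"

text \<open>Substituting \<open>y = 1 / h\<close>, this controls the difference quotient of
  \<open>flat_exp p\<close> at \<open>0\<close> from the right.\<close>

lemma poly_exp_tendsto_0: "((\<lambda>y::real. poly p y * exp (- y)) \<longlongrightarrow> 0) at_top"
proof -
  have "((\<lambda>y::real. \<Sum>i\<le>degree p. coeff p i * (y ^ i / exp y)) \<longlongrightarrow> 0) at_top"
    by (intro tendsto_null_sum tendsto_mult_right_zero tendsto_power_div_exp_0)
  then show ?thesis
    by (simp add: poly_altdef sum_distrib_right exp_minus divide_inverse mult.assoc)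
qed

text \<open>With \<open>y = 1 / t\<close>, the \<open>y\<close>-derivative of
  \<open>p(y) exp (- y)\<close> is \<open>(p' - p)(y) exp (- y)\<close>, and
  \<open>dy/dt = - y^2\<close>; hence the new polynomial is \<open>y^2 (p - p')\<close>.\<close>

lemma flat_exp_has_derivative:
  "(flat_exp p has_real_derivative flat_exp ([:0, 0, 1:] * (p - pderiv p)) t) (at t)"
proof -
  consider "t > 0" | "t < 0" | "t = 0" by linarith
  then show ?thesis
  proof cases
    case 1
    have "((\<lambda>t. poly p (1 / t) * exp (- 1 / t)) has_real_derivative
        flat_exp ([:0, 0, 1:] * (p - pderiv p)) t) (at t)"
      using 1 by (auto intro!: derivative_eq_intros poly_DERIV[THEN DERIV_chain2]
          simp: flat_exp_def field_simps power2_eq_square)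
    then show ?thesis
      by (rule has_field_derivative_transform_within_open[where S = "{0<..}"])
         (use 1 in \<open>auto simp: flat_exp_def\<close>)
  next
    case 2
    have "((\<lambda>_. 0) has_real_derivative flat_exp ([:0, 0, 1:] * (p - pderiv p)) t) (at t)"
      using 2 by (simp add: flat_exp_def)
    then show ?thesis
      by (rule has_field_derivative_transform_within_open[where S = "{..<0}"])
         (use 2 in \<open>auto simp: flat_exp_def\<close>)
  next
    case 3
    \<comment> \<open>At \<open>t = 0\<close> the difference quotient is
      \<open>flat_exp p h / h\<close>. For \<open>h > 0\<close> its factor \<open>1 / h\<close> is
      absorbed into the polynomial as \<open>[:0, 1:]\<close>, and \<open>1 / h\<close> tends to
      infinity.\<close>
    have "((\<lambda>h. poly ([:0, 1:] * p) (inverse h) * exp (- inverse h)) \<longlongrightarrow> 0) (at_right (0::real))"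
      by (rule filterlim_compose[OF poly_exp_tendsto_0 filterlim_inverse_at_top_right])
    moreover have "eventually (\<lambda>h. poly ([:0, 1:] * p) (inverse h) * exp (- inverse h) = flat_exp p h / h)
        (at_right 0)"
      using eventually_at_right_less[of "0::real"]
      by eventually_elim (auto simp: flat_exp_def field_simps)
    ultimately have "((\<lambda>h. flat_exp p h / h) \<longlongrightarrow> 0) (at_right 0)"
      by (rule Lim_transform_eventually)
    \<comment> \<open>For \<open>h < 0\<close> the quotient is identically \<open>0\<close>.\<close>
    moreover have "((\<lambda>h. flat_exp p h / h) \<longlongrightarrow> 0) (at_left 0)"
      by (rule tendsto_eventually) (auto simp: flat_exp_def eventually_at_filter)
    ultimately show ?thesis
      unfolding 3 has_field_derivative_iff by (auto simp: flat_exp_def[of _ 0] filterlim_split_at)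
  qed
qed

text \<open>Differentiating in direction \<open>b\<close> changes the polynomial and adds the
  constant factor \<open>b \<bullet> v\<close>, so the induction runs over all polynomials at once.
  Affine arguments are what the faces of a box require.\<close>

lemma Ck_flat_exp: "Ck k (\<lambda>x. flat_exp p (x \<bullet> v + c))"
proof (induction k arbitrary: p)
  case 0
  have "continuous_on UNIV (flat_exp p)"
    by (meson DERIV_isCont continuous_at_imp_continuous_on flat_exp_has_derivative)
  then show ?case
    by (auto intro!: continuous_intros continuous_on_compose2[of UNIV "flat_exp p"])
next
  case (Suc k)
  let ?q = "[:0, 0, 1:] * (p - pderiv p)"
  have der: "((\<lambda>x. flat_exp p (x \<bullet> v + c)) has_derivative (\<lambda>b. flat_exp ?q (x \<bullet> v + c) * (b \<bullet> v))) (at x)"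
    for x
    by (rule has_derivative_compose[OF _ has_field_derivative_imp_has_derivative[OF flat_exp_has_derivative]])
       (auto intro!: derivative_eq_intros)
  then have "frechet_derivative (\<lambda>x. flat_exp p (x \<bullet> v + c)) (at x) = (\<lambda>b. flat_exp ?q (x \<bullet> v + c) * (b \<bullet> v))"
    for x
    by (rule frechet_derivative_at[symmetric])
  with der show ?case
    unfolding Ck.simps differentiable_def by (auto intro!: Ck_mult Suc Ck_const simp del: mult_pCons_left)
qed

text \<open>Since \<open>flat_exp 1 t\<close> is \<open>exp (- 1 / t)\<close> for
  \<open>t > 0\<close>, the two factors for \<open>b\<close> are this function at \<open>n\<close>
  times the signed distances to the two faces orthogonal to \<open>b\<close>. The arguments are
  spelled in the affine form of \<open>Ck_flat_exp\<close>.\<close>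

definition box_bump :: "'a::euclidean_space \<Rightarrow> 'a \<Rightarrow> real \<Rightarrow> 'a \<Rightarrow> real" where
  "box_bump a c n x = (\<Prod>b\<in>Basis. flat_exp 1 (x \<bullet> (n *\<^sub>R b) + - (n * (a \<bullet> b)))
      * flat_exp 1 (x \<bullet> (- n *\<^sub>R b) + n * (c \<bullet> b)))"

lemma box_bump_eq_0:
  assumes "n > 0" "x \<notin> box a c"
  shows "box_bump a c n x = 0"
proof -
  obtain b where "b \<in> Basis" "x \<bullet> b \<le> a \<bullet> b \<or> c \<bullet> b \<le> x \<bullet> b"
    using assms(2) by (auto simp: mem_box not_less)
  then show ?thesis
    using assms(1) unfolding box_bump_def
    by (intro prod_zero[OF finite_Basis] bexI[of _ b]) (auto simp: flat_exp_def)
qed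

lemma box_bump_bounds: "0 \<le> box_bump a c n x" "box_bump a c n x \<le> 1"
  by (auto simp: box_bump_def flat_exp_def intro!: prod_nonneg prod_le_1 mult_le_one)

lemma flat_exp_tendsto_1:
  assumes "s > 0"
  shows "(\<lambda>n. flat_exp 1 (real (Suc n) * s)) \<longlonglongrightarrow> 1"
proof -
  have "(\<lambda>n. exp (- (1 / s) * inverse (real (Suc n)))) \<longlonglongrightarrow> exp (- (1 / s) * 0)"
    by (intro tendsto_intros LIMSEQ_inverse_real_of_nat)
  moreover have "flat_exp 1 (real (Suc n) * s) = exp (- (1 / s) * inverse (real (Suc n)))" for n
    using assms by (auto simp: flat_exp_def divide_simps mult_pos_pos)
  ultimately show ?thesis by simp
qed

text \<open>Inside the box every scaled distance tends to infinity, where \<open>flat_exp 1\<close>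
  tends to \<open>1\<close>; outside, some factor vanishes for every positive scale. The scale
  \<open>Suc n\<close> stays positive from the start.\<close>

lemma box_bump_tendsto:
  "(\<lambda>n. box_bump a c (real (Suc n)) x) \<longlonglongrightarrow> indicator (box a c) x"
proof (cases "x \<in> box a c")
  case True
  have "(\<lambda>n. \<Prod>b\<in>Basis. flat_exp 1 (real (Suc n) * (x \<bullet> b - a \<bullet> b)) * flat_exp 1 (real (Suc n) * (c \<bullet> b - x \<bullet> b)))
      \<longlonglongrightarrow> (\<Prod>b\<in>(Basis::'a set). 1 * 1)"
    using True by (intro tendsto_prod tendsto_mult flat_exp_tendsto_1) (auto simp: mem_box)
  then show ?thesis
    using True by (simp add: box_bump_def algebra_simps)
next
  case False
  then show ?thesis by (simp add: box_bump_eq_0)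
qed

text \<open>The support is the closure of a subset of the open box, so it is the closed box that has
  to lie in \<Omega>.\<close>

lemma test_function_box_bump:
  assumes "n > 0" "cbox a c \<subseteq> \<Omega>"
  shows "test_function \<Omega> (box_bump a c n)"
proof -
  have "{x. box_bump a c n x \<noteq> 0} \<subseteq> cbox a c"
    using box_bump_eq_0[OF assms(1)] box_subset_cbox by blast
  then have *: "closure {x. box_bump a c n x \<noteq> 0} \<subseteq> cbox a c"
    by (rule closure_minimal[OF _ closed_cbox])
  then have "compact (closure {x. box_bump a c n x \<noteq> 0})"
    using bounded_subset[OF bounded_cbox *] by (simp add: compact_eq_bounded_closed)
  moreover have "smooth (box_bump a c n)"
    unfolding smooth_def box_bump_def[abs_def] by (intro allI Ck_prod Ck_mult Ck_flat_exp)
  ultimately show ?thesis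
    using * assms(2) by (auto simp: test_function_def)
qed

section \<open>The fundamental lemma of the calculus of variations\<close>

lemma finite_measure_lebesgue_on_open:
  fixes \<Omega> :: "'a::euclidean_space set"
  assumes "open \<Omega>" "bounded \<Omega>"
  shows "finite_measure (lebesgue_on \<Omega>)"
  by (rule finite_measure_lebesgue_on) (simp add: assms lmeasurable_open)

text \<open>Open boxes are an intersection-stable generator of the Borel sets, and the sets over
  which \<open>g\<close> integrates to zero are closed under complements and countable disjoint
  unions. So all Borel integrals of \<open>g\<close> vanish.\<close>

lemma lborel_AE_zero_if_boxes_zero:
  fixes g :: "'a::euclidean_space \<Rightarrow> real"
  assumes int: "integrable lborel g"
    and box: "\<And>a b. (LINT x:box a b|lborel. g x) = 0"
  shows "AE x in lborel. g x = 0"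
proof (rule sigma_finite_measure.density_zero[OF sigma_finite_lborel int])
  have gen: "(UNIV::'a set) = (\<Union>n. box (- real n *\<^sub>R One) (real n *\<^sub>R One))"
    by (simp add: UN_box_eq_UNIV)
  have si: "set_integrable lborel A g" if "A \<in> sets borel" for A
    using integrable_mult_indicator[OF _ int] that unfolding set_integrable_def by simp
  \<comment> \<open>Complements need the integral over the whole space, which is the limit along the
    growing boxes.\<close>
  have whole: "(LINT x:UNIV|lborel. g x) = 0"
  proof -
    have incseq: "incseq (\<lambda>n. box (- real n *\<^sub>R One) (real n *\<^sub>R One) :: 'a set)"
      by (intro incseq_SucI subset_box_imp) simp
    have "(\<lambda>n. LINT x:box (- real n *\<^sub>R One) (real n *\<^sub>R One)|lborel. g x)
        \<longlonglongrightarrow> (LINT x:(\<Union>n. box (- real n *\<^sub>R One) (real n *\<^sub>R One))|lborel. g x)"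
      by (rule set_integral_cont_up) (use incseq in \<open>simp_all add: gen[symmetric] si\<close>)
    then show ?thesis by (simp only: box LIMSEQ_const_iff gen[symmetric])
  qed
  have stable: "Int_stable (range (\<lambda>(a, b). box a b) :: 'a set set)"
    by (auto simp: Int_stable_def box_Int_box image_iff)
  fix A :: "'a set" assume "A \<in> sets lborel"
  then have A: "A \<in> sigma_sets UNIV (range (\<lambda>(a, b). box a b))"
    by (simp add: borel_eq_box)
  have sub: "range (\<lambda>(a, b). box a b) \<subseteq> Pow (UNIV :: 'a set)"
    by simp
  from stable sub A show "(LINT x:A|lborel. g x) = 0"
  proof (induction rule: sigma_sets_induct_disjoint)
    case (basic A)
    then show ?case by (auto simp: box)
  next
    case empty
    then show ?case by (simp add: set_lebesgue_integral_def)
  next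
    case (compl A)
    then have A: "A \<in> sets borel"
      by (simp add: borel_eq_box)
    have "(LINT x:A \<union> (UNIV - A)|lborel. g x) = (LINT x:A|lborel. g x) + (LINT x:UNIV - A|lborel. g x)"
      by (rule set_integral_Un) (use A si in auto)
    then show ?case using compl whole by simp
  next
    case (union A)
    then have A: "A i \<in> sets borel" for i
      by (auto simp: borel_eq_box)
    have "(LINT x:(\<Union>i. A i)|lborel. g x) = (\<Sum>i. (LINT x:(A i)|lborel. g x))"
      using union.hyps A by (intro lebesgue_integral_countable_add si) (auto simp: disjoint_family_on_def)
    then show ?case using union by simp
  qed
qed

text \<open>Boxes generate only the Borel sets, so \<open>f\<close> is first replaced by a Borel
  function that agrees with it almost everywhere.\<close>

lemma lebesgue_AE_zero_if_boxes_zero: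
  fixes f :: "'a::euclidean_space \<Rightarrow> real"
  assumes int: "integrable lebesgue f"
    and box: "\<And>a b. (LINT x:box a b|lebesgue. f x) = 0"
  shows "AE x in lebesgue. f x = 0"
proof -
  obtain g where g: "g \<in> borel_measurable lborel" and eq: "AE x in lborel. f x = g x"
    using completion_ex_borel_measurable_real[OF borel_measurable_integrable[OF int]] by blast
  have eq': "AE x in lebesgue. f x = g x"
    using eq by (rule AE_completion)
  have "integrable lebesgue g"
    using int eq' g by (subst integrable_cong_AE[of _ _ f]) (auto simp: measurable_completion)
  then have "integrable lborel g"
    using g by (simp add: integrable_completion)
  moreover have "(LINT x:box a b|lborel. g x) = 0" for a b
  proof -
    have "(LINT x:box a b|lborel. g x) = (LINT x:box a b|lebesgue. g x)"
      using g unfolding set_lebesgue_integral_def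
      by (intro integral_completion[symmetric]) auto
    also have "\<dots> = (LINT x:box a b|lebesgue. f x)"
      unfolding set_lebesgue_integral_def 
    proof (rule integral_cong_AE)
      show "(\<lambda>x. indicat_real (box a b) x *\<^sub>R g x) \<in> borel_measurable lebesgue"
        using g by (intro borel_measurable_scaleR borel_measurable_indicator measurable_completion[of g]) auto
      show "(\<lambda>x. indicat_real (box a b) x *\<^sub>R f x) \<in> borel_measurable lebesgue"
        using int by (intro borel_measurable_scaleR borel_measurable_indicator borel_measurable_integrable) auto
    qed (use eq' in auto)
    finally show ?thesis using box by simp
  qed
  ultimately have "AE x in lborel. g x = 0"
    by (rule lborel_AE_zero_if_boxes_zero)
  then show ?thesis
    using eq' AE_completion by fastforce
qed

lemma continuous_borel_measurable_lebesgue_on: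
  fixes f :: "'a::euclidean_space \<Rightarrow> 'b::euclidean_space"
  assumes "continuous_on UNIV f"
  shows "f \<in> borel_measurable (lebesgue_on \<Omega>)"
  using assms by (intro measurable_restrict_space1 measurable_completion)
    (simp add: borel_measurable_continuous_onI)

lemma test_function_continuous: "test_function \<Omega> \<phi> \<Longrightarrow> continuous_on UNIV \<phi>"
  by (auto simp: test_function_def smooth_def intro: Ck_imp_continuous[of 0])

lemma AE_zero_if_orthogonal_to_test_functions:
  fixes f :: "'a::euclidean_space \<Rightarrow> real"
  assumes "open \<Omega>" and int: "integrable (lebesgue_on \<Omega>) f"
    and test: "\<And>\<phi>. test_function \<Omega> \<phi> \<Longrightarrow> (\<integral>x. f x * \<phi> x \<partial>lebesgue_on \<Omega>) = 0"
  shows "AE x in lebesgue_on \<Omega>. f x = 0"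
proof -
  have \<Omega>: "\<Omega> \<inter> space lebesgue \<in> sets lebesgue"
    using \<open>open \<Omega>\<close> by simp
  \<comment> \<open>The bumps for the box are admissible test functions with values between
    \<open>0\<close> and \<open>1\<close>. Dominated convergence with bound
    \<open>norm (f x)\<close> carries the vanishing pairings over to the indicator.\<close>
  have inner: "(\<integral>x. indicator (box a c) x * f x \<partial>lebesgue_on \<Omega>) = 0" if "cbox a c \<subseteq> \<Omega>" for a c
  proof -
    have "(\<lambda>n. \<integral>x. f x * box_bump a c (real (Suc n)) x \<partial>lebesgue_on \<Omega>)
        \<longlonglongrightarrow> (\<integral>x. indicator (box a c) x * f x \<partial>lebesgue_on \<Omega>)"
    proof (rule integral_dominated_convergence[where w = "\<lambda>x. norm (f x)"])
      show "(\<lambda>x. f x * box_bump a c (real (Suc n)) x) \<in> borel_measurable (lebesgue_on \<Omega>)" for n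
        using test_function_continuous[OF test_function_box_bump[OF _ that], of "real (Suc n)"] int
        by (intro borel_measurable_times continuous_borel_measurable_lebesgue_on[of "box_bump _ _ _"]) auto
      show "(\<lambda>x. indicator (box a c) x * f x) \<in> borel_measurable (lebesgue_on \<Omega>)"
        using int
        by (intro borel_measurable_times borel_measurable_indicator borel_measurable_integrable)
           (use that box_subset_cbox[of a c] in \<open>auto simp: sets_restrict_space_iff[OF \<Omega>]\<close>)
      show "AE x in lebesgue_on \<Omega>. (\<lambda>n. f x * box_bump a c (real (Suc n)) x)
          \<longlonglongrightarrow> indicator (box a c) x * f x"
        by (subst mult.commute[of "indicator _ _"])
           (intro AE_I2 tendsto_mult tendsto_const box_bump_tendsto)
      show "AE x in lebesgue_on \<Omega>. norm (f x * box_bump a c (real (Suc n)) x) \<le> norm (f x)" for n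
        by (auto simp: abs_mult box_bump_bounds simp del: of_nat_Suc intro!: AE_I2 mult_left_le)
    qed (use int in auto)
    moreover have "(\<integral>x. f x * box_bump a c (real (Suc n)) x \<partial>lebesgue_on \<Omega>) = 0" for n
      using that by (intro test test_function_box_bump) auto
    ultimately show ?thesis by (simp add: LIMSEQ_const_iff)
  qed
  \<comment> \<open>Localization: \<open>f\<close> is cut off to one box inside \<Omega>. Integrals
    of the cut-off function over arbitrary boxes are integrals of \<open>f\<close> over
    intersections, which are boxes again.\<close>
  have on_cbox: "AE x in lebesgue. x \<in> cbox a c \<longrightarrow> f x = 0" if sub: "cbox a c \<subseteq> \<Omega>" for a c
  proof -
    have int': "integrable lebesgue (\<lambda>x. indicator \<Omega> x *\<^sub>R f x)"
      using int \<Omega> by (simp add: integrable_restrict_space)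
    have eq: "indicator (box a c) x *\<^sub>R indicator \<Omega> x *\<^sub>R f x = indicator (box a c) x * f x" for x
      using sub box_subset_cbox[of a c] by (auto simp: indicator_def)
    have "AE x in lebesgue. indicator (box a c) x * f x = 0"
    proof (rule lebesgue_AE_zero_if_boxes_zero)
      show "integrable lebesgue (\<lambda>x. indicator (box a c) x * f x)"
        using integrable_mult_indicator[OF _ int', of "box a c"] unfolding eq by simp
      fix p q
      obtain p' q' where pq: "box p q \<inter> box a c = box p' q'"
        using box_Int_box[of p q a c] by blast
      show "(LINT x:box p q|lebesgue. indicator (box a c) x * f x) = 0"
      \<comment> \<open>The closure of a nonempty open box is its closed box, which gives
        \<open>cbox p' q' \<subseteq> \<Omega>\<close>. For an empty box the corners carry no such
        information, but then the integrand is zero.\<close>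
      proof (cases "box p' q' = {}")
        case True
        with pq have "indicator (box p q) x * (indicator (box a c) x * f x) = 0" for x
          by (auto simp: indicator_def)
        then show ?thesis by (simp only: set_lebesgue_integral_def real_scaleR_def) simp
      next
        case False
        have "box p' q' \<subseteq> cbox a c"
          using pq box_subset_cbox[of a c] by blast
        then have "cbox p' q' \<subseteq> \<Omega>"
          using closure_minimal[of "box p' q'" "cbox a c"] closure_box[OF False] sub by auto
        then have "x \<in> \<Omega>" if "x \<in> box p' q'" for x
          using that box_subset_cbox[of p' q'] by blast
        then have "indicator (box p q) x *\<^sub>R (indicator (box a c) x * f x)
            = indicator \<Omega> x *\<^sub>R (indicator (box p' q') x * f x)" for x
          using pq by (auto simp: indicator_def set_eq_iff)
        then have "(LINT x:box p q|lebesgue. indicator (box a c) x * f x)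
            = (\<integral>x. indicator (box p' q') x * f x \<partial>lebesgue_on \<Omega>)"
          by (simp only: set_lebesgue_integral_def integral_restrict_space[OF \<Omega>])
        then show ?thesis
          using inner[OF \<open>cbox p' q' \<subseteq> \<Omega>\<close>] by simp
      qed
    qed
    \<comment> \<open>The faces of the box form a null set, so the result extends to the closed
      box.\<close>
    moreover have "AE x in lebesgue. x \<notin> cbox a c - box a c"
      using negligible_frontier_interval[of a c]
      by (intro AE_not_in) (simp add: negligible_iff_null_sets)
    ultimately show ?thesis
      by eventually_elim (auto simp: indicator_def split: if_splits)
  qed
  \<comment> \<open>Countably many closed boxes exhaust \<Omega>, so their exceptional null sets
    unite to a null set.\<close>
  obtain \<D> where \<D>: "countable \<D>" "\<D> \<subseteq> Pow \<Omega>" "\<And>X. X \<in> \<D> \<Longrightarrow> \<exists>a b. X = cbox a b" "\<Union>\<D> = \<Omega>"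
    using open_countable_Union_open_cbox[OF \<open>open \<Omega>\<close>] by metis
  have "AE x in lebesgue. \<forall>X\<in>\<D>. x \<in> X \<longrightarrow> f x = 0"
    unfolding AE_ball_countable[OF \<D>(1)]
  proof
    fix X assume "X \<in> \<D>"
    then obtain a b where "X = cbox a b" "cbox a b \<subseteq> \<Omega>"
      using \<D>(2,3) by blast
    with on_cbox show "AE x in lebesgue. x \<in> X \<longrightarrow> f x = 0"
      by blast
  qed
  then have "AE x in lebesgue. x \<in> \<Omega> \<longrightarrow> f x = 0"
    using \<D>(4) by auto
  then show ?thesis by (simp add: AE_restrict_space_iff[OF \<Omega>])
qed

section \<open>Linearity of the weak gradient\<close>

lemma L2_add_scaleR:
  assumes "f \<in> L2 M" "g \<in> L2 M"
  shows "(\<lambda>x. f x + c *\<^sub>R g x) \<in> L2 M"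
proof -
  have "integrable M (\<lambda>x. 2 * (norm (f x))\<^sup>2 + 2 * c\<^sup>2 * (norm (g x))\<^sup>2)"
    using assms by (auto simp: L2_def)
  moreover have meas: "(\<lambda>x. f x + c *\<^sub>R g x) \<in> borel_measurable M"
    using assms by (auto simp: L2_def)
  then have "(\<lambda>x. (norm (f x + c *\<^sub>R g x))\<^sup>2) \<in> borel_measurable M"
    by measurable
  \<comment> \<open>The inequality \<open>(a + b)^2 \<le> 2 a^2 + 2 b^2\<close> provides an
    integrable majorant.\<close>
  moreover have "(norm (f x + c *\<^sub>R g x))\<^sup>2 \<le> 2 * (norm (f x))\<^sup>2 + 2 * c\<^sup>2 * (norm (g x))\<^sup>2" for x
  proof -
    have "(norm (f x + c *\<^sub>R g x))\<^sup>2 \<le> (norm (f x) + \<bar>c\<bar> * norm (g x))\<^sup>2"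
      using norm_triangle_ineq[of "f x" "c *\<^sub>R g x"] by (intro power_mono) auto
    also have "\<dots> \<le> 2 * (norm (f x))\<^sup>2 + 2 * (\<bar>c\<bar> * norm (g x))\<^sup>2"
      using sum_squares_bound[of "norm (f x)" "\<bar>c\<bar> * norm (g x)"] by (simp add: power2_sum)
    finally show ?thesis
      by (simp add: power_mult_distrib)
  qed
  then have "AE x in M. norm ((norm (f x + c *\<^sub>R g x))\<^sup>2)
      \<le> norm (2 * (norm (f x))\<^sup>2 + 2 * c\<^sup>2 * (norm (g x))\<^sup>2)"
    by (intro AE_I2) simp
  ultimately have "integrable M (\<lambda>x. (norm (f x + c *\<^sub>R g x))\<^sup>2)"
    by (rule Bochner_Integration.integrable_bound)
  with meas show ?thesis by (simp add: L2_def)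
qed

lemma integrable_inner_L2:
  assumes "f \<in> L2 M" "g \<in> L2 M"
  shows "integrable M (\<lambda>x. f x \<bullet> g x)"
proof (rule Bochner_Integration.integrable_bound)
  show "integrable M (\<lambda>x. (norm (f x))\<^sup>2 + (norm (g x))\<^sup>2)"
    using assms by (auto simp: L2_def)
  show "(\<lambda>x. f x \<bullet> g x) \<in> borel_measurable M"
    using assms by (auto simp: L2_def)
  \<comment> \<open>Cauchy-Schwarz followed by \<open>2 a b \<le> a^2 + b^2\<close>; as
    \<open>a b \<ge> 0\<close>, the factor \<open>2\<close> may be dropped.\<close>
  have "\<bar>f x \<bullet> g x\<bar> \<le> (norm (f x))\<^sup>2 + (norm (g x))\<^sup>2" for x
    using Cauchy_Schwarz_ineq2[of "f x" "g x"] sum_squares_bound[of "norm (f x)" "norm (g x)"]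
      mult_nonneg_nonneg[OF norm_ge_zero[of "f x"] norm_ge_zero[of "g x"]] by linarith
  then show "AE x in M. norm (f x \<bullet> g x) \<le> norm ((norm (f x))\<^sup>2 + (norm (g x))\<^sup>2)"
    by (auto intro!: AE_I2)
qed

text \<open>On a finite measure space the bounded field \<open>h x *\<^sub>R b\<close> is square
  integrable, and the integrand is its inner product with \<open>f\<close>. With \<open>b\<close> a
  basis vector this pairs a component of \<open>f\<close> with a test function.\<close>

lemma L2_inner_const_times_bounded:
  assumes "finite_measure M" "f \<in> L2 M" "h \<in> borel_measurable M" "\<And>x. \<bar>h x\<bar> \<le> B"
  shows "integrable M (\<lambda>x. (f x \<bullet> b) * h x)"
proof -
  interpret finite_measure M by fact
  have "(\<lambda>x. h x *\<^sub>R b) \<in> L2 M"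
    unfolding L2_def
  proof (intro CollectI conjI integrable_const_bound)
    have "(\<bar>h x\<bar> * norm b)\<^sup>2 \<le> (B * norm b)\<^sup>2" for x
      using assms(4)[of x] by (intro power_mono mult_right_mono) auto
    then show "AE x in M. norm ((norm (h x *\<^sub>R b))\<^sup>2) \<le> (B * norm b)\<^sup>2"
      by (auto intro!: AE_I2)
  qed (use assms in auto)
  from integrable_inner_L2[OF assms(2) this] show ?thesis
    by (simp add: mult.commute)
qed

lemma l2_inner_commute: "l2_inner M f g = l2_inner M g f"
  by (simp add: l2_inner_def inner_commute)

lemma l2_inner_add_scaleR_left:
  assumes "f \<in> L2 M" "g \<in> L2 M" "h \<in> L2 M"
  shows "l2_inner M (\<lambda>x. f x + c *\<^sub>R g x) h = l2_inner M f h + c * l2_inner M g h"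
  using integrable_inner_L2[OF assms(1,3)] integrable_inner_L2[OF assms(2,3)]
  by (simp add: l2_inner_def inner_add_left)

text \<open>Because \<open>wgrad\<close> is a chosen representative, identities between gradients
  hold only almost everywhere; this lemma carries them into inner products.\<close>

lemma l2_inner_cong_AE:
  assumes "AE x in M. f x = f' x" "AE x in M. g x = g' x"
    and "f \<in> L2 M" "f' \<in> L2 M" "g \<in> L2 M" "g' \<in> L2 M"
  shows "l2_inner M f g = l2_inner M f' g'"
  unfolding l2_inner_def
proof (rule integral_cong_AE)
  show "AE x in M. f x \<bullet> g x = f' x \<bullet> g' x"
    using assms(1,2) by eventually_elim simp
qed (use assms(3-) in \<open>auto simp: L2_def\<close>)

lemma l2_inner_add_scaleR_self:
  assumes "f \<in> L2 M" "g \<in> L2 M"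
  shows "l2_inner M (\<lambda>x. f x + c *\<^sub>R g x) (\<lambda>x. f x + c *\<^sub>R g x)
    = l2_inner M f f + 2 * c * l2_inner M f g + c\<^sup>2 * l2_inner M g g"
proof -
  let ?h = "\<lambda>x. f x + c *\<^sub>R g x"
  have "l2_inner M ?h ?h = l2_inner M ?h f + c * l2_inner M ?h g"
    using assms by (simp add: l2_inner_add_scaleR_left L2_add_scaleR
        l2_inner_commute[of M f ?h] l2_inner_commute[of M g ?h])
  then show ?thesis
    using assms by (simp add: l2_inner_add_scaleR_left l2_inner_commute[of M g f] power2_eq_square algebra_simps)
qed

lemma induced_l2_norm_power2: "(l2_norm M f)\<^sup>2 = l2_inner M f f"
  by (simp add: induced_norm_def l2_inner_def)

section \<open>Boundedness of test functions and their derivatives\<close>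

lemma bounded_if_zero_outside_compact:
  fixes g :: "'a::euclidean_space \<Rightarrow> real"
  assumes "continuous_on UNIV g" "compact K" "\<And>x. x \<notin> K \<Longrightarrow> g x = 0"
  obtains B where "\<And>x. \<bar>g x\<bar> \<le> B"
proof -
  have "bounded (g ` K)"
    using assms by (meson compact_continuous_image compact_imp_bounded continuous_on_subset subset_UNIV)
  then obtain B where "\<And>x. x \<in> K \<Longrightarrow> \<bar>g x\<bar> \<le> B"
    by (auto simp: bounded_iff)
  \<comment> \<open>The bound \<open>B\<close> may be negative when \<open>K\<close> is empty;
    \<open>max B 0\<close> also covers the value \<open>0\<close> outside \<open>K\<close>.\<close>
  then have "\<bar>g x\<bar> \<le> max B 0" for x
    using assms(3)[of x] by (cases "x \<in> K") (auto simp: le_max_iff_disj)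
  then show ?thesis by (rule that)
qed

lemma test_function_bounded:
  assumes "test_function \<Omega> \<phi>"
  obtains B where "\<And>x. \<bar>\<phi> x\<bar> \<le> B"
proof (rule bounded_if_zero_outside_compact)
  show "continuous_on UNIV \<phi>" using assms by (rule test_function_continuous)
  show "compact (closure {x. \<phi> x \<noteq> 0})" using assms by (simp add: test_function_def)
  show "\<phi> x = 0" if "x \<notin> closure {x. \<phi> x \<noteq> 0}" for x
    using that closure_subset[of "{x. \<phi> x \<noteq> 0}"] by blast
qed (use that in blast)

lemma
  assumes "test_function \<Omega> \<phi>" "b \<in> Basis"
  shows test_function_derivative_continuous:
      "continuous_on UNIV (\<lambda>x. frechet_derivative \<phi> (at x) b)" (is ?thesis1)
    and test_function_derivative_bounded: "\<exists>B. \<forall>x. \<bar>frechet_derivative \<phi> (at x) b\<bar> \<le> B" (is ?thesis2)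
proof -
  have "Ck (Suc 0) \<phi>"
    using assms(1) unfolding test_function_def smooth_def by blast
  then show cont: ?thesis1
    using assms(2) by simp
  let ?K = "closure {x. \<phi> x \<noteq> 0}"
  \<comment> \<open>The complement of the support is open and \<open>\<phi>\<close> vanishes on it,
    so the derivative vanishes there too.\<close>
  have zero: "frechet_derivative \<phi> (at x) b = 0" if "x \<notin> ?K" for x
  proof -
    have "((\<lambda>_. 0) has_derivative (\<lambda>_. 0)) (at x)"
      by simp
    then have "(\<phi> has_derivative (\<lambda>_. 0)) (at x)"
      by (rule has_derivative_transform_within_open[of _ _ _ _ "- ?K"])
         (use that closure_subset[of "{x. \<phi> x \<noteq> 0}"] in auto)
    then show ?thesis
      using frechet_derivative_at by metis
  qed
  obtain B where "\<And>x. \<bar>frechet_derivative \<phi> (at x) b\<bar> \<le> B"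
    using bounded_if_zero_outside_compact[of "\<lambda>x. frechet_derivative \<phi> (at x) b" ?K, OF cont]
      zero assms(1) by (auto simp: test_function_def)
  then show ?thesis2 by blast
qed

lemma integrable_L2_times_test_function:
  fixes f :: "'a::euclidean_space \<Rightarrow> 'b::euclidean_space"
  assumes "open \<Omega>" "bounded \<Omega>" "f \<in> L2 (lebesgue_on \<Omega>)" "test_function \<Omega> \<phi>"
  shows "integrable (lebesgue_on \<Omega>) (\<lambda>x. (f x \<bullet> e) * \<phi> x)"
    and "b \<in> Basis \<Longrightarrow> integrable (lebesgue_on \<Omega>) (\<lambda>x. (f x \<bullet> e) * frechet_derivative \<phi> (at x) b)"
proof -
  have fin: "finite_measure (lebesgue_on \<Omega>)"
    using assms(1,2) by (rule finite_measure_lebesgue_on_open)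
  obtain B where B: "\<And>x. \<bar>\<phi> x\<bar> \<le> B"
    using test_function_bounded[OF assms(4)] by blast
  show "integrable (lebesgue_on \<Omega>) (\<lambda>x. (f x \<bullet> e) * \<phi> x)"
    by (rule L2_inner_const_times_bounded[OF fin assms(3) _ B])
       (intro continuous_borel_measurable_lebesgue_on test_function_continuous[OF assms(4)])
  assume b: "b \<in> Basis"
  obtain B' where B': "\<And>x. \<bar>frechet_derivative \<phi> (at x) b\<bar> \<le> B'"
    using test_function_derivative_bounded[OF assms(4) b] by blast
  show "integrable (lebesgue_on \<Omega>) (\<lambda>x. (f x \<bullet> e) * frechet_derivative \<phi> (at x) b)"
    by (rule L2_inner_const_times_bounded[OF fin assms(3) _ B'])
       (intro continuous_borel_measurable_lebesgue_on test_function_derivative_continuous[OF assms(4) b])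
qed

section \<open>Linearity and uniqueness of weak gradients\<close>

lemma vec_nth_eq_inner: "(x::real^'n) $ i = x \<bullet> axis i 1"
  by (simp add: inner_axis)

text \<open>Written as inner products with a fixed element, entries of vector and matrix fields
  alike fall under \<open>integrable_L2_times_test_function\<close>.\<close>

lemma mat_nth_eq_inner: "(A::real^'n^'m) $ i $ j = A \<bullet> axis i (axis j 1)"
  by (simp add: inner_axis)

lemma weak_gradient_add_scaleR:
  fixes u v :: "real^'d \<Rightarrow> real^'l"
  assumes \<Omega>: "open \<Omega>" "bounded \<Omega>"
    and L2: "u \<in> L2 (lebesgue_on \<Omega>)" "v \<in> L2 (lebesgue_on \<Omega>)"
      "G \<in> L2 (lebesgue_on \<Omega>)" "H \<in> L2 (lebesgue_on \<Omega>)"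
    and weak: "weak_gradient \<Omega> u G" "weak_gradient \<Omega> v H"
  shows "weak_gradient \<Omega> (\<lambda>x. u x + c *\<^sub>R v x) (\<lambda>x. G x + c *\<^sub>R H x)"
  unfolding weak_gradient_def
proof (intro allI impI)
  fix \<phi> :: "real^'d \<Rightarrow> real" and i :: 'l and j :: 'd
  assume \<phi>: "test_function \<Omega> \<phi>"
  let ?M = "lebesgue_on \<Omega>" and ?d = "\<lambda>x. frechet_derivative \<phi> (at x) (axis j 1)"
  \<comment> \<open>Non-integrable functions have integral \<open>0\<close> by default, so splitting
    the integrals below rests on integrability of each summand.\<close>
  note int = integrable_L2_times_test_function[OF \<Omega> _ \<phi>]
  have intu: "integrable ?M (\<lambda>x. f x $ i * ?d x)" if "f \<in> L2 ?M" for f :: "real^'d \<Rightarrow> real^'l"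
    unfolding vec_nth_eq_inner by (rule int(2)[OF that]) (simp add: axis_in_Basis_iff)
  have intG: "integrable ?M (\<lambda>x. F x $ i $ j * \<phi> x)" if "F \<in> L2 ?M" for F :: "real^'d \<Rightarrow> real^'d^'l"
    unfolding mat_nth_eq_inner by (rule int(1)[OF that])
  have "(\<integral>x. (u x + c *\<^sub>R v x) $ i * ?d x \<partial>?M)
      = (\<integral>x. u x $ i * ?d x \<partial>?M) + c * (\<integral>x. v x $ i * ?d x \<partial>?M)"
    using intu L2 by (simp add: distrib_right mult.assoc)
  also have "\<dots> = - ((\<integral>x. G x $ i $ j * \<phi> x \<partial>?M) + c * (\<integral>x. H x $ i $ j * \<phi> x \<partial>?M))"
    using weak \<phi> by (simp add: weak_gradient_def)
  also have "(\<integral>x. G x $ i $ j * \<phi> x \<partial>?M) + c * (\<integral>x. H x $ i $ j * \<phi> x \<partial>?M)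
      = (\<integral>x. (G x + c *\<^sub>R H x) $ i $ j * \<phi> x \<partial>?M)"
    using intG L2 by (simp add: distrib_right mult.assoc)
  finally show "(\<integral>x. (u x + c *\<^sub>R v x) $ i * ?d x \<partial>?M) = - (\<integral>x. (G x + c *\<^sub>R H x) $ i $ j * \<phi> x \<partial>?M)" .
qed

text \<open>Subtracting the two defining equations shows each entry of \<open>G - H\<close> to be
  orthogonal to all test functions, so it vanishes almost everywhere; there are finitely many
  entries.\<close>

lemma weak_gradient_unique:
  fixes u :: "real^'d \<Rightarrow> real^'l"
  assumes \<Omega>: "open \<Omega>" "bounded \<Omega>"
    and L2: "G \<in> L2 (lebesgue_on \<Omega>)" "H \<in> L2 (lebesgue_on \<Omega>)"
    and weak: "weak_gradient \<Omega> u G" "weak_gradient \<Omega> u H"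
  shows "AE x in lebesgue_on \<Omega>. G x = H x"
proof -
  let ?M = "lebesgue_on \<Omega>"
  have comp: "AE x in ?M. G x $ i $ j - H x $ i $ j = 0" for i j
  proof (rule AE_zero_if_orthogonal_to_test_functions[OF \<Omega>(1)])
    \<comment> \<open>The domain has finite measure, so square integrable entries are integrable:
      take the bounded factor to be \<open>1\<close>.\<close>
    have "integrable ?M (\<lambda>x. F x $ i $ j)" if "F \<in> L2 ?M" for F :: "real^'d \<Rightarrow> real^'d^'l"
      using L2_inner_const_times_bounded[OF finite_measure_lebesgue_on_open[OF \<Omega>] that, of "\<lambda>_. 1" 1]
      by (simp add: mat_nth_eq_inner)
    then show "integrable ?M (\<lambda>x. G x $ i $ j - H x $ i $ j)"
      using L2 by simp
    fix \<phi> :: "real^'d \<Rightarrow> real" assume \<phi>: "test_function \<Omega> \<phi>"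
    have "integrable ?M (\<lambda>x. F x $ i $ j * \<phi> x)" if "F \<in> L2 ?M" for F :: "real^'d \<Rightarrow> real^'d^'l"
      unfolding mat_nth_eq_inner by (rule integrable_L2_times_test_function[OF \<Omega> that \<phi>])
    moreover have "(\<integral>x. G x $ i $ j * \<phi> x \<partial>?M) = (\<integral>x. H x $ i $ j * \<phi> x \<partial>?M)"
      using weak[unfolded weak_gradient_def, rule_format, OF \<phi>, of i j] by linarith
    ultimately show "(\<integral>x. (G x $ i $ j - H x $ i $ j) * \<phi> x \<partial>?M) = 0"
      using L2 by (simp add: left_diff_distrib)
  qed
  have "AE x in ?M. \<forall>i j. G x $ i $ j - H x $ i $ j = 0"
    by (intro eventually_all_finite comp)
  then show ?thesis
    by eventually_elim (simp add: vec_eq_iff)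
qed

lemma
  assumes "u \<in> H1 \<Omega>"
  shows H1_imp_L2: "u \<in> L2 (lebesgue_on \<Omega>)"
    and wgrad_in_L2: "wgrad \<Omega> u \<in> L2 (lebesgue_on \<Omega>)"
    and weak_gradient_wgrad: "weak_gradient \<Omega> u (wgrad \<Omega> u)"
proof -
  from assms show "u \<in> L2 (lebesgue_on \<Omega>)"
    by (simp add: H1_def)
  from assms have "\<exists>G. G \<in> L2 (lebesgue_on \<Omega>) \<and> weak_gradient \<Omega> u G"
    by (auto simp: H1_def)
  then have "wgrad \<Omega> u \<in> L2 (lebesgue_on \<Omega>) \<and> weak_gradient \<Omega> u (wgrad \<Omega> u)"
    unfolding wgrad_def by (rule someI_ex)
  then show "wgrad \<Omega> u \<in> L2 (lebesgue_on \<Omega>)" "weak_gradient \<Omega> u (wgrad \<Omega> u)"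
    by auto
qed

text \<open>The combination \<open>?G\<close> of the chosen gradients is itself a square integrable
  weak gradient of the combination, so uniqueness identifies it with the chosen one almost
  everywhere.\<close>

lemma
  assumes \<Omega>: "open \<Omega>" "bounded \<Omega>" and u: "u \<in> H1 \<Omega>" and v: "v \<in> H1 \<Omega>"
  shows H1_add_scaleR: "(\<lambda>x. u x + c *\<^sub>R v x) \<in> H1 \<Omega>" (is ?thesis1)
    and wgrad_add_scaleR:
      "AE x in lebesgue_on \<Omega>. wgrad \<Omega> (\<lambda>x. u x + c *\<^sub>R v x) x = wgrad \<Omega> u x + c *\<^sub>R wgrad \<Omega> v x"
      (is ?thesis2)
proof -
  let ?w = "\<lambda>x. u x + c *\<^sub>R v x" and ?G = "\<lambda>x. wgrad \<Omega> u x + c *\<^sub>R wgrad \<Omega> v x"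
  note props = H1_imp_L2 wgrad_in_L2 weak_gradient_wgrad
  have G: "?G \<in> L2 (lebesgue_on \<Omega>)"
    by (intro L2_add_scaleR wgrad_in_L2 u v)
  have weak: "weak_gradient \<Omega> ?w ?G"
    by (intro weak_gradient_add_scaleR \<Omega> props u v)
  show w: ?thesis1
    unfolding H1_def using G weak L2_add_scaleR[OF props(1)[OF u] props(1)[OF v]] by blast
  show ?thesis2
    by (rule weak_gradient_unique[OF \<Omega> wgrad_in_L2[OF w] G weak_gradient_wgrad[OF w] weak])
qed

text \<open>Both expansions hold for the explicit gradient \<open>?G\<close> by bilinearity; almost
  everywhere equality then replaces \<open>?G\<close> by the chosen gradient.\<close>

lemma
  assumes \<Omega>: "open \<Omega>" "bounded \<Omega>" and u: "u \<in> H1 \<Omega>" and v: "v \<in> H1 \<Omega>"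
  shows grad_inner_add_scaleR_left:
      "w \<in> H1 \<Omega> \<Longrightarrow> grad_inner \<Omega> (\<lambda>x. u x + c *\<^sub>R v x) w = grad_inner \<Omega> u w + c * grad_inner \<Omega> v w"
    and grad_inner_add_scaleR_self:
      "grad_inner \<Omega> (\<lambda>x. u x + c *\<^sub>R v x) (\<lambda>x. u x + c *\<^sub>R v x)
        = grad_inner \<Omega> u u + 2 * c * grad_inner \<Omega> u v + c\<^sup>2 * grad_inner \<Omega> v v"
proof -
  let ?G = "\<lambda>x. wgrad \<Omega> u x + c *\<^sub>R wgrad \<Omega> v x"
  have G: "?G \<in> L2 (lebesgue_on \<Omega>)"
    by (intro L2_add_scaleR wgrad_in_L2 u v)
  note wL2 = wgrad_in_L2[OF H1_add_scaleR[OF \<Omega> u v]]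
  show "grad_inner \<Omega> (\<lambda>x. u x + c *\<^sub>R v x) (\<lambda>x. u x + c *\<^sub>R v x)
        = grad_inner \<Omega> u u + 2 * c * grad_inner \<Omega> u v + c\<^sup>2 * grad_inner \<Omega> v v"
    unfolding grad_inner_def l2_inner_add_scaleR_self[OF wgrad_in_L2[OF u] wgrad_in_L2[OF v], symmetric]
    by (intro l2_inner_cong_AE wgrad_add_scaleR \<Omega> u v wL2 G)
  assume w: "w \<in> H1 \<Omega>"
  show "grad_inner \<Omega> (\<lambda>x. u x + c *\<^sub>R v x) w = grad_inner \<Omega> u w + c * grad_inner \<Omega> v w"
    unfolding grad_inner_def
      l2_inner_add_scaleR_left[OF wgrad_in_L2[OF u] wgrad_in_L2[OF v] wgrad_in_L2[OF w], symmetric]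
    by (intro l2_inner_cong_AE wgrad_add_scaleR \<Omega> u v wL2 G wgrad_in_L2[OF w]) simp
qed

section \<open>The energy identity\<close>

theorem proposition3p1:
  fixes \<Omega> \<Gamma>D :: "(real^'d) set"
    and uD :: "real^'d \<Rightarrow> real^'l"
    and star :: "(real^'d \<Rightarrow> real^'l) \<Rightarrow> (real^'d \<Rightarrow> real^'l) \<Rightarrow> real"
    and \<theta> \<mu> :: real
    and \<tau> :: "nat \<Rightarrow> real"
    and u :: "nat \<Rightarrow> real^'d \<Rightarrow> real^'l"
    and m :: nat
  assumes domain: "bounded_lipschitz_domain \<Omega>"
    and dirichlet_part: "\<Gamma>D \<subseteq> frontier \<Omega>" "\<Gamma>D \<in> sets (surface_measure \<Omega>)"
      "emeasure (surface_measure \<Omega>) \<Gamma>D > 0"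
    and dirichlet_data: "\<exists>w\<in>H1 \<Omega>. unit_length \<Omega> w \<and> has_trace_on \<Omega> \<Gamma>D w uD"
    and star: "star = l2_inner (lebesgue_on \<Omega>) \<or> star = grad_inner \<Omega>"
    and theta: "0 < \<theta>" "\<theta> \<le> 1"
    and mu: "0 \<le> \<mu>" "\<mu> \<le> 1"
    and steps: "\<And>n. n \<ge> 1 \<Longrightarrow> \<tau> n > 0"
    and scheme: "theta_mu_method \<Omega> \<Gamma>D uD star \<theta> \<mu> \<tau> u"
    and m: "m \<ge> 2"
  shows "1 / 2 * (l2_norm (lebesgue_on \<Omega>) (wgrad \<Omega> (u m)))\<^sup>2
      + (\<Sum>n=1..m. \<tau> n * (induced_norm star (dt \<tau> u n))\<^sup>2)
      + (\<tau> 1)\<^sup>2 / 2 * (l2_norm (lebesgue_on \<Omega>) (wgrad \<Omega> (dt \<tau> u 1)))\<^sup>2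
      + (\<theta> - 1 / 2) *
          (\<Sum>n=2..m. (\<tau> n)\<^sup>2 * (l2_norm (lebesgue_on \<Omega>) (wgrad \<Omega> (dt \<tau> u n)))\<^sup>2)
    = 1 / 2 * (l2_norm (lebesgue_on \<Omega>) (wgrad \<Omega> (u 0)))\<^sup>2"
proof -
  have \<Omega>: "open \<Omega>" "bounded \<Omega>"
    using domain by (auto simp: bounded_lipschitz_domain_def)
  let ?g = "grad_inner \<Omega>" and ?d = "dt \<tau> u"
  from scheme have u0: "u 0 \<in> H1 \<Omega>" and start: "euler_start \<Omega> \<Gamma>D star \<tau> u"
    and step: "\<And>n. n \<ge> 2 \<Longrightarrow> theta_mu_step \<Omega> \<Gamma>D star \<theta> \<mu> \<tau> u n"
    by (auto simp: theta_mu_method_def)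
  \<comment> \<open>The scheme governs indices from \<open>1\<close> on: \<open>1\<close> by the
    Euler start, all later ones by the \<theta>-\<mu> step.\<close>
  have d_H1D: "?d (Suc n) \<in> H1D \<Omega> \<Gamma>D" for n
    using start step[of "Suc n"] by (cases n) (auto simp: euler_start_def theta_mu_step_def)
  then have d: "?d (Suc n) \<in> H1 \<Omega>" for n
    by (simp add: H1D_def)
  have update: "u (Suc n) = (\<lambda>x. u n x + \<tau> (Suc n) *\<^sub>R ?d (Suc n) x)" for n
    using steps[of "Suc n"] by (simp add: dt_def)
  have u: "u n \<in> H1 \<Omega>" for n
  proof (induction n)
    case (Suc n)
    show ?case by (subst update) (intro H1_add_scaleR \<Omega> Suc d)
  qed (rule u0)
  \<comment> \<open>Needed at the end to undo the square root in
    \<open>induced_norm star\<close>.\<close>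
  have star_nonneg: "star v v \<ge> 0" for v
    using star by (auto simp: grad_inner_def l2_inner_def)
  \<comment> \<open>The binomial expansion of the squared gradient norm at the update,
    halved.\<close>
  have energy: "?g (u (Suc n)) (u (Suc n)) / 2 = ?g (u n) (u n) / 2
      + \<tau> (Suc n) * ?g (u n) (?d (Suc n)) + (\<tau> (Suc n))\<^sup>2 / 2 * ?g (?d (Suc n)) (?d (Suc n))" for n
    by (subst (1 2) update, subst grad_inner_add_scaleR_self[OF \<Omega> u d]) (simp add: field_simps)
  \<comment> \<open>The first increment is admissible as its own test function. The Euler equation
    combines the gradients themselves, so linearity of \<open>l2_inner\<close> splits it.\<close>
  have test_euler: "star (?d 1) (?d 1) + (?g (u 0) (?d 1) + \<tau> 1 * ?g (?d 1) (?d 1)) = 0"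
    using start unfolding euler_start_def grad_inner_def One_nat_def
    by (simp flip: l2_inner_add_scaleR_left[OF wgrad_in_L2[OF u0] wgrad_in_L2[OF d] wgrad_in_L2[OF d]])
  \<comment> \<open>Again the increment tests its own equation, being tangential to the same
    extrapolation as the test functions. Here the gradient of a combination occurs, so almost
    everywhere linearity of \<open>wgrad\<close> enters through
    \<open>grad_inner_add_scaleR_left\<close>.\<close>
  have test_step: "star (?d (Suc n)) (?d (Suc n))
      + (?g (u n) (?d (Suc n)) + \<theta> * \<tau> (Suc n) * ?g (?d (Suc n)) (?d (Suc n))) = 0" if "n \<ge> 1" for n
    using step[of "Suc n"] that
    by (simp add: theta_mu_step_def flip: grad_inner_add_scaleR_left[OF \<Omega> u d d])
  \<comment> \<open>The induction starts at \<open>m = 1\<close>, where the sum from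
    \<open>n = 2\<close> is empty and only the Euler step contributes.\<close>
  have "?g (u m) (u m) / 2 + (\<Sum>n=1..m. \<tau> n * star (?d n) (?d n))
      + (\<tau> 1)\<^sup>2 / 2 * ?g (?d 1) (?d 1)
      + (\<theta> - 1 / 2) * (\<Sum>n=2..m. (\<tau> n)\<^sup>2 * ?g (?d n) (?d n)) = ?g (u 0) (u 0) / 2"
    if "m \<ge> 1" for m
    using that
  proof (induction m rule: nat_induct_at_least)
    case base
    have cross: "?g (u 0) (?d 1) = - star (?d 1) (?d 1) - \<tau> 1 * ?g (?d 1) (?d 1)"
      using test_euler by linarith
    \<comment> \<open>The tested equation contributes \<open>- \<tau>^2\<close> and the expansion
      \<open>\<tau>^2 / 2\<close>, leaving the dissipation \<open>\<tau>^2 / 2\<close> of implicit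
      Euler.\<close>
    have "?g (u 1) (u 1) / 2 + \<tau> 1 * star (?d 1) (?d 1) + (\<tau> 1)\<^sup>2 / 2 * ?g (?d 1) (?d 1) = ?g (u 0) (u 0) / 2"
      unfolding energy[of 0, folded One_nat_def] cross by (simp add: field_simps power2_eq_square)
    then show ?case
      by simp
  next
    case (Suc m)
    let ?n = "Suc m"
    have cross: "?g (u m) (?d ?n) = - star (?d ?n) (?d ?n) - \<theta> * \<tau> ?n * ?g (?d ?n) (?d ?n)"
      using test_step[OF Suc.hyps] by linarith
    \<comment> \<open>Likewise \<open>\<tau>^2 / 2 - \<theta> \<tau>^2\<close> yields the
      coefficient \<open>\<theta> - 1 / 2\<close> on the left.\<close>
    have "?g (u ?n) (u ?n) / 2 + \<tau> ?n * star (?d ?n) (?d ?n)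
        + (\<theta> - 1 / 2) * ((\<tau> ?n)\<^sup>2 * ?g (?d ?n) (?d ?n)) = ?g (u m) (u m) / 2"
      unfolding energy cross by (simp add: field_simps power2_eq_square)
    with Suc show ?case
      by (simp add: distrib_left)
  qed
  from this[of m] m show ?thesis
    by (simp add: induced_l2_norm_power2 induced_norm_def[of star] star_nonneg grad_inner_def)
qed

end
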